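(* For all integers $n,k$ with $1\le k\le n$: (i) $B_{n,k}(\widehat T_1,\ldots,\widehat T_{n-k+1})=\binom{n-1}{k-1}\widehat P_{n-k,n}$; (ii) $A_{n,k}(\widehat T_1,\ldots,\widehat T_{n-k+1})=\binom nk\widehat P_{n-k,-k}$.
   Context: $\mathbb{K}$ is a field of characteristic zero. Partial Bell polynomials: $B_{0,0}=1$, $B_{n,0}=0$ ($n\ge1$), $B_{n,k}=0$ ($k>n$), and for $1\le k\le n$, $B_{n,k}=\sum\frac{n!}{\prod_ir_i!(i!)^{r_i}}\prod_iX_i^{r_i}$ over non-negative integers with $\sum r_i=k$, $\sum ir_i=n$. $A_{n,k}\in\mathbb{K}[X_1^{-1},X_1,X_2,\ldots]$ is the unique lower triangular family with $A_{0,0}=1$, $A_{n,0}=0$ ($n\ge1$) and $\sum_{j=k}^nA_{n,j}B_{j,k}=\delta_{nk}$. Potential polynomials: $\widehat P_{n,r}:=\sum_{j=0}^n r(r-1)\cdots(r-j+1)X_0^{r-j}B_{n,j}$ for $n\ge0$, $r\in\mathbb{Z}$ (Laurent in $X_0$). Tree polynomials: $\widehat T_n:=\sum_{k=0}^{n-1}n(n-1)\cdots(n-k+1)X_0^{n-k}B_{n-1,k}$ $(n\ge1)$, a polynomial in $X_0,\ldots,X_{n-1}$. $P(H_1,H_2,\ldots)$ means substitution of $H_j$ for $X_j$. *)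

theory Defs
  imports Complex_Main "HOL-Library.Poly_Mapping"
begin

text \<open>
  All polynomials live in the Laurent polynomial ring over \<open>'a\<close> in the indeterminates
  \<open>X\<^sub>0, X\<^sub>1, X\<^sub>2, \<dots>\<close>: finitely supported functions from (integer) exponent vectors to
  coefficients, with the convolution product.
\<close>

type_synonym 'a laurent = "(nat \<Rightarrow>\<^sub>0 int) \<Rightarrow>\<^sub>0 'a"

definition const :: "'a::comm_ring_1 \<Rightarrow> 'a laurent" where
  "const c = Poly_Mapping.single 0 c"

definition X_powi :: "nat \<Rightarrow> int \<Rightarrow> 'a::comm_ring_1 laurent" where
  "X_powi i e = Poly_Mapping.single (Poly_Mapping.single i e) 1"

abbreviation X :: "nat \<Rightarrow> 'a::comm_ring_1 laurent" where
  "X i \<equiv> X_powi i 1"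

text \<open>The subring \<open>K[X\<^sub>1\<^sup>-\<^sup>1, X\<^sub>1, X\<^sub>2, \<dots>]\<close>.\<close>

definition laurent_X1 :: "'a::comm_ring_1 laurent set" where
  "laurent_X1 = {p. \<forall>m \<in> Poly_Mapping.keys p.
     Poly_Mapping.lookup m 0 = 0 \<and> (\<forall>i\<ge>2. Poly_Mapping.lookup m i \<ge> 0)}"

text \<open>
  Negative powers are meaningful for units only; the inverse in a commutative ring is unique.
\<close>

definition unit_inv :: "'b::comm_ring_1 \<Rightarrow> 'b" where
  "unit_inv x = (THE y. x * y = 1)"

definition unit_powi :: "'b::comm_ring_1 \<Rightarrow> int \<Rightarrow> 'b" where
  "unit_powi x e = (if e \<ge> 0 then x ^ nat e else unit_inv x ^ nat (- e))"

text \<open>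
  \<open>subst H p\<close> is \<open>p(H\<^sub>0, H\<^sub>1, H\<^sub>2, \<dots>)\<close>; \<open>H j\<close> only matters if \<open>X\<^sub>j\<close> occurs in \<open>p\<close>, and it
  has to be a unit if \<open>X\<^sub>j\<close> occurs with a negative exponent.
\<close>

definition subst :: "(nat \<Rightarrow> 'a::comm_ring_1 laurent) \<Rightarrow> 'a laurent \<Rightarrow> 'a laurent" where
  "subst H p = (\<Sum>m \<in> Poly_Mapping.keys p. const (Poly_Mapping.lookup p m) *
     (\<Prod>i \<in> Poly_Mapping.keys m. unit_powi (H i) (Poly_Mapping.lookup m i)))"

text \<open>
  In the index set, \<open>\<Sum>i. i * r i = n\<close> forces \<open>r i = 0\<close> for all \<open>i > n\<close>.
\<close>

definition bell_index :: "nat \<Rightarrow> nat \<Rightarrow> (nat \<Rightarrow> nat) set" where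
  "bell_index n k = {r. (\<forall>i. i \<notin> {1..n} \<longrightarrow> r i = 0) \<and>
     (\<Sum>i=1..n. r i) = k \<and> (\<Sum>i=1..n. i * r i) = n}"

definition bell :: "nat \<Rightarrow> nat \<Rightarrow> 'a::field_char_0 laurent" where
  "bell n k =
     (if n = 0 \<and> k = 0 then 1
      else if k = 0 \<or> n < k then 0
      else (\<Sum>r \<in> bell_index n k.
        const (fact n / (\<Prod>i=1..n. fact (r i) * fact i ^ r i)) * (\<Prod>i=1..n. X i ^ r i)))"

definition is_inverse_bell_family :: "(nat \<Rightarrow> nat \<Rightarrow> 'a::field_char_0 laurent) \<Rightarrow> bool" where
  "is_inverse_bell_family A \<longleftrightarrow>
     (\<forall>n k. A n k \<in> laurent_X1) \<and>
     (\<forall>n k. n < k \<longrightarrow> A n k = 0) \<and>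
     A 0 0 = 1 \<and> (\<forall>n\<ge>1. A n 0 = 0) \<and>
     (\<forall>n k. (\<Sum>j=k..n. A n j * bell j k) = (if n = k then 1 else 0))"

definition inverse_bell :: "nat \<Rightarrow> nat \<Rightarrow> 'a::field_char_0 laurent" where
  "inverse_bell = (THE A. is_inverse_bell_family A)"

definition falling :: "int \<Rightarrow> nat \<Rightarrow> 'a::comm_ring_1" where
  "falling r j = (\<Prod>i<j. of_int (r - int i))"

definition potential :: "nat \<Rightarrow> int \<Rightarrow> 'a::field_char_0 laurent" where
  "potential n r = (\<Sum>j=0..n. const (falling r j) * X_powi 0 (r - int j) * bell n j)"

text \<open>Only \<open>tree n\<close> with \<open>n \<ge> 1\<close> is meaningful; \<open>tree 0 = 0\<close> is a dummy value.\<close>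

definition tree :: "nat \<Rightarrow> 'a::field_char_0 laurent" where
  "tree n = (\<Sum>k<n. const (falling (int n) k) * X 0 ^ (n - k) * bell (n - 1) k)"

end

theory Submission
  imports Defs "HOL-Computational_Algebra.Formal_Power_Series"
begin

text \<open>
  Write \<open>\<phi> = \<Sum>n\<ge>0. X\<^sub>n y\<^sup>n / n!\<close>. The potential polynomials are the coefficients
  of the powers of \<open>\<phi>\<close>, namely \<open>\<phi>\<^sup>r = \<Sum>n. P n r y\<^sup>n / n!\<close> for every integer \<open>r\<close>, and
  \<open>B n k = n!/k! [y\<^sup>n] (\<phi> - X\<^sub>0)\<^sup>k\<close>. As \<open>T n = P (n - 1) n\<close>, Lagrange inversion says that
  the exponential generating function \<open>T\<close> of the tree polynomials is the compositional inverse of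
  \<open>y / \<phi>\<close>, with \<open>[x\<^sup>n] T\<^sup>k = k/n [y\<^sup>n\<^sup>-\<^sup>k] \<phi>\<^sup>n\<close>; this is the first claim. The matrices
  \<open>[x\<^sup>n] T\<^sup>k\<close> and \<open>[y\<^sup>n] (y / \<phi>)\<^sup>k\<close> are inverse to each other, and the latter has the entries
  \<open>[y\<^sup>n\<^sup>-\<^sup>k] \<phi>\<^sup>-\<^sup>k\<close>, which gives the second claim because a left inverse of a triangular matrix with
  nonzero diagonal is unique.
\<close>

section \<open>Constants and powers of a single indeterminate\<close>

lemma const_0 [simp]: "const 0 = 0"
  by (simp add: const_def)

lemma const_1 [simp]: "const 1 = 1"
  by (simp add: const_def)

lemma const_add: "const (a + b) = const a + const b"
  by (simp add: const_def single_add)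

lemma const_mult: "const (a * b) = const a * const b"
  by (simp add: const_def mult_single)

lemma const_of_nat: "const (of_nat n) = of_nat n"
  by (simp add: const_def)

lemma const_of_int: "const (of_int n) = of_int n"
  by (simp add: const_def)

lemma const_sum: "const (sum f S) = (\<Sum>x\<in>S. const (f x))"
  by (induction S rule: infinite_finite_induct) (simp_all add: const_add)

lemma const_prod: "const (prod f S) = (\<Prod>x\<in>S. const (f x))"
  by (induction S rule: infinite_finite_induct) (simp_all add: const_mult)

lemma const_power: "const (a ^ n) = const a ^ n"
  by (induction n) (simp_all add: const_mult)

lemma const_eq_0_iff [simp]: "const a = 0 \<longleftrightarrow> a = 0"
  by (metis const_def lookup_single_eq lookup_zero single_zero)

lemma X_powi_0 [simp]: "X_powi i 0 = 1"
  by (simp add: X_powi_def)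

lemma X_powi_add: "X_powi i (a + b) = X_powi i a * X_powi i b"
  by (simp add: X_powi_def mult_single single_add)

lemma X_powi_power: "X_powi i a ^ n = X_powi i (int n * a)"
  by (induction n) (simp_all add: X_powi_add [symmetric] algebra_simps)

lemma X_powi_nonzero [simp]: "(X_powi i a :: 'a::comm_ring_1 laurent) \<noteq> 0"
  unfolding X_powi_def by (metis lookup_single_eq lookup_zero zero_neq_one)

section \<open>Inverses and integer powers of units\<close>

lemma unit_mult_inv: "x dvd 1 \<Longrightarrow> x * unit_inv x = 1"
proof -
  assume "x dvd 1"
  then obtain y where y: "x * y = 1"
    by (metis dvdE)
  moreover have "z = y" if "x * z = 1" for z
    using that y by (metis mult.commute mult.left_commute mult.right_neutral)
  ultimately show ?thesis
    unfolding unit_inv_def by (rule theI)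
qed

lemma unit_powi_0 [simp]: "unit_powi x 0 = 1"
  by (simp add: unit_powi_def)

lemma unit_powi_1 [simp]: "unit_powi x 1 = x"
  by (simp add: unit_powi_def)

text \<open>Writing an exponent as \<open>int p - int q\<close> covers both signs by one product,
  from which additivity for units follows without sign cases.\<close>

lemma unit_powi_diff:
  assumes "x dvd 1"
  shows "unit_powi x (int p - int q) = x ^ p * unit_inv x ^ q"
proof (cases "q \<le> p")
  case True
  then obtain d where "p = d + q"
    by (metis add.commute le_Suc_ex)
  moreover have "x ^ q * unit_inv x ^ q = 1"
    using unit_mult_inv [OF assms] by (simp flip: power_mult_distrib)
  ultimately show ?thesis
    by (simp add: unit_powi_def power_add mult.assoc)
next
  case False
  then obtain d where d: "q = p + d" "d > 0"
    by (metis less_imp_add_positive not_le)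
  moreover have "x ^ p * unit_inv x ^ p = 1"
    using unit_mult_inv [OF assms] by (simp flip: power_mult_distrib)
  ultimately show ?thesis
    by (simp add: unit_powi_def power_add flip: mult.assoc)
qed

lemma unit_powi_add:
  assumes "x dvd 1 \<or> a \<ge> 0 \<and> b \<ge> 0"
  shows "unit_powi x (a + b) = unit_powi x a * unit_powi x b"
proof (cases "x dvd 1")
  case True
  obtain p q where a: "a = int p - int q"
    by (rule int_diff_cases)
  obtain p' q' where b: "b = int p' - int q'"
    by (rule int_diff_cases)
  have "a + b = int (p + p') - int (q + q')"
    by (simp add: a b)
  then show ?thesis
    unfolding a b by (simp only: unit_powi_diff [OF True]) (simp add: power_add ac_simps)
next
  case False
  with assms show ?thesis
    by (simp add: unit_powi_def nat_add_distrib power_add)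
qed

section \<open>Substitution into Laurent polynomials\<close>

definition eval_monom :: "(nat \<Rightarrow> 'a::comm_ring_1 laurent) \<Rightarrow> (nat \<Rightarrow>\<^sub>0 int) \<Rightarrow> 'a laurent" where
  "eval_monom H m = (\<Prod>i\<in>Poly_Mapping.keys m. unit_powi (H i) (Poly_Mapping.lookup m i))"

text \<open>An exponent 0 gives the factor 1, so any finite superset of the support may index the
  product; different monomials can thus share an index set.\<close>

lemma eval_monom_superset:
  assumes "finite S" "Poly_Mapping.keys m \<subseteq> S"
  shows "eval_monom H m = (\<Prod>i\<in>S. unit_powi (H i) (Poly_Mapping.lookup m i))"
  unfolding eval_monom_def
  by (rule prod.mono_neutral_left) (use assms in \<open>auto simp: in_keys_iff\<close>)

lemma eval_monom_0 [simp]: "eval_monom H 0 = 1"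
  by (simp add: eval_monom_def)

lemma eval_monom_add:
  assumes "\<And>i. H i dvd 1 \<or> Poly_Mapping.lookup a i \<ge> 0 \<and> Poly_Mapping.lookup b i \<ge> 0"
  shows "eval_monom H (a + b) = eval_monom H a * eval_monom H b"
proof -
  let ?S = "Poly_Mapping.keys a \<union> Poly_Mapping.keys b"
  have "eval_monom H (a + b) = (\<Prod>i\<in>?S. unit_powi (H i) (Poly_Mapping.lookup (a + b) i))"
    by (rule eval_monom_superset) (simp_all add: Poly_Mapping.keys_add)
  also have "\<dots> = eval_monom H a * eval_monom H b"
    using assms
    by (simp add: eval_monom_superset [of ?S] lookup_add unit_powi_add flip: prod.distrib)
  finally show ?thesis .
qed

lemma subst_superset:
  assumes "finite S" "Poly_Mapping.keys p \<subseteq> S"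
  shows "subst H p = (\<Sum>m\<in>S. const (Poly_Mapping.lookup p m) * eval_monom H m)"
  unfolding subst_def eval_monom_def [symmetric]
  by (rule sum.mono_neutral_left) (use assms in \<open>auto simp: in_keys_iff\<close>)

lemma subst_0 [simp]: "subst H 0 = 0"
  by (simp add: subst_def)

lemma subst_add: "subst H (p + q) = subst H p + subst H q"
proof -
  let ?S = "Poly_Mapping.keys p \<union> Poly_Mapping.keys q"
  have "subst H (p + q) = (\<Sum>m\<in>?S. const (Poly_Mapping.lookup (p + q) m) * eval_monom H m)"
    by (rule subst_superset) (simp_all add: Poly_Mapping.keys_add)
  then show ?thesis
    by (simp add: subst_superset [of ?S] lookup_add const_add distrib_right sum.distrib)
qed

lemma subst_sum: "subst H (sum f S) = (\<Sum>x\<in>S. subst H (f x))"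
  by (induction S rule: infinite_finite_induct) (simp_all add: subst_add)

lemma subst_single: "subst H (Poly_Mapping.single m c) = const c * eval_monom H m"
  by (simp add: subst_superset [of "{m}"])

lemma sum_single_lookup:
  "(\<Sum>m\<in>Poly_Mapping.keys p. Poly_Mapping.single m (Poly_Mapping.lookup p m)) = p"
  by (rule poly_mapping_eqI) (auto simp: lookup_sum lookup_single when_def in_keys_iff)

text \<open>Expanding both factors into monomials reduces this to \<open>eval_monom_add\<close>,
  which may fail when a negative exponent meets a nonunit; the hypothesis excludes that.\<close>

lemma subst_mult:
  assumes "\<And>a b i. a \<in> Poly_Mapping.keys p \<Longrightarrow> b \<in> Poly_Mapping.keys q \<Longrightarrow>
    H i dvd 1 \<or> Poly_Mapping.lookup a i \<ge> 0 \<and> Poly_Mapping.lookup b i \<ge> 0"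
  shows "subst H (p * q) = subst H p * subst H q"
proof -
  have "p * q = (\<Sum>a\<in>Poly_Mapping.keys p. \<Sum>b\<in>Poly_Mapping.keys q.
      Poly_Mapping.single (a + b) (Poly_Mapping.lookup p a * Poly_Mapping.lookup q b))"
    by (subst (1 2) sum_single_lookup [symmetric]) (simp only: sum_product mult_single)
  also have "subst H \<dots> = (\<Sum>a\<in>Poly_Mapping.keys p. \<Sum>b\<in>Poly_Mapping.keys q.
      (const (Poly_Mapping.lookup p a) * eval_monom H a) *
      (const (Poly_Mapping.lookup q b) * eval_monom H b))"
    using assms
    by (auto simp: subst_sum subst_single const_mult eval_monom_add ac_simps intro!: sum.cong)
  also have "\<dots> = subst H p * subst H q"
    by (simp add: subst_def eval_monom_def sum_product)
  finally show ?thesis .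
qed

lemma subst_const [simp]: "subst H (const c) = const c"
  by (simp add: const_def [of c] subst_single)

lemma subst_1 [simp]: "subst H 1 = 1"
  using subst_const [of H 1] by simp

lemma subst_X [simp]: "subst H (X i) = H i"
  by (simp add: X_powi_def subst_single eval_monom_def)

section \<open>The subring \<open>laurent_X1\<close> and substitution on it\<close>

lemma laurent_X1_0 [simp]: "0 \<in> laurent_X1"
  by (simp add: laurent_X1_def)

lemma laurent_X1_const [simp]: "const c \<in> laurent_X1"
  by (simp add: laurent_X1_def const_def)

lemma laurent_X1_1 [simp]: "1 \<in> laurent_X1"
  using laurent_X1_const [of 1] by simp

lemma laurent_X1_X1_powi [simp]: "X_powi 1 a \<in> laurent_X1"
  by (simp add: laurent_X1_def X_powi_def lookup_single when_def)

lemma laurent_X1_X [simp]: "i \<ge> 1 \<Longrightarrow> X i \<in> laurent_X1"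
  by (simp add: laurent_X1_def X_powi_def lookup_single when_def)

lemma laurent_X1_uminus: "p \<in> laurent_X1 \<Longrightarrow> - p \<in> laurent_X1"
  by (simp add: laurent_X1_def in_keys_iff)

lemma laurent_X1_add: "p \<in> laurent_X1 \<Longrightarrow> q \<in> laurent_X1 \<Longrightarrow> p + q \<in> laurent_X1"
  using Poly_Mapping.keys_add [of p q] by (fastforce simp: laurent_X1_def)

lemma laurent_X1_mult: "p \<in> laurent_X1 \<Longrightarrow> q \<in> laurent_X1 \<Longrightarrow> p * q \<in> laurent_X1"
  using Poly_Mapping.keys_mult [of p q] by (fastforce simp: laurent_X1_def lookup_add)

lemma laurent_X1_sum: "(\<And>x. x \<in> S \<Longrightarrow> f x \<in> laurent_X1) \<Longrightarrow> sum f S \<in> laurent_X1"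
  by (induction S rule: infinite_finite_induct) (simp_all add: laurent_X1_add)

lemma laurent_X1_prod: "(\<And>x. x \<in> S \<Longrightarrow> f x \<in> laurent_X1) \<Longrightarrow> prod f S \<in> laurent_X1"
  by (induction S rule: infinite_finite_induct) (simp_all add: laurent_X1_mult)

lemma laurent_X1_power: "p \<in> laurent_X1 \<Longrightarrow> p ^ n \<in> laurent_X1"
  by (induction n) (simp_all add: laurent_X1_mult)

text \<open>On \<open>laurent_X1\<close> only \<open>X 1\<close> can carry a negative exponent, so
  it suffices that \<open>H 1\<close> is a unit.\<close>

lemma subst_mult_X1:
  assumes "H 1 dvd 1" "p \<in> laurent_X1" "q \<in> laurent_X1"
  shows "subst H (p * q) = subst H p * subst H q"
proof (rule subst_mult)
  fix a b i
  assume "a \<in> Poly_Mapping.keys p" "b \<in> Poly_Mapping.keys q"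
  with assms show "H i dvd 1 \<or> Poly_Mapping.lookup a i \<ge> 0 \<and> Poly_Mapping.lookup b i \<ge> 0"
    by (cases "i = 0"; cases "i = 1") (auto simp: laurent_X1_def)
qed

lemma subst_prod_X1:
  assumes "H 1 dvd 1" "\<And>x. x \<in> S \<Longrightarrow> f x \<in> laurent_X1"
  shows "subst H (prod f S) = (\<Prod>x\<in>S. subst H (f x))"
  using assms(2)
  by (induction S rule: infinite_finite_induct) (simp_all add: subst_mult_X1 [where H = H, OF assms(1)] laurent_X1_prod)

lemma subst_power_X1:
  assumes "H 1 dvd 1" "p \<in> laurent_X1"
  shows "subst H (p ^ n) = subst H p ^ n"
  using subst_prod_X1 [of H "{..<n}" "\<lambda>_. p"] assms by simp

section \<open>Bell polynomials as coefficients of powers of an exponential generating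
  function\<close>

lemma finite_bounded_partitions:
  "finite {r :: nat \<Rightarrow> nat. (\<forall>i. i \<notin> {1..N} \<longrightarrow> r i = 0) \<and> (\<Sum>i=1..N. r i) = k \<and> (\<Sum>i=1..N. i * r i) = n}"
    (is "finite ?W")
proof (rule finite_subset)
  show "?W \<subseteq> {r. \<forall>i. (i \<in> {1..N} \<longrightarrow> r i \<in> {..k}) \<and> (i \<notin> {1..N} \<longrightarrow> r i = 0)}"
  proof
    fix r assume r: "r \<in> ?W"
    have "r i \<le> k" if "i \<in> {1..N}" for i
      using member_le_sum [of i "{1..N}" r] r that by simp
    with r show "r \<in> {r. \<forall>i. (i \<in> {1..N} \<longrightarrow> r i \<in> {..k}) \<and> (i \<notin> {1..N} \<longrightarrow> r i = 0)}"
      by simp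
  qed
  show "finite {r. \<forall>i. (i \<in> {1..N} \<longrightarrow> r i \<in> {..k}) \<and> (i \<notin> {1..N} \<longrightarrow> r i = 0)}"
    by (rule finite_set_of_finite_funs) auto
qed

text \<open>
  Multiplying by \<open>k + 1 = \<Sum>i. r i\<close> and lowering \<open>r i\<close> by one in the \<open>i\<close>-th term turns the
  multinomial sum for \<open>k + 1\<close> into the convolution that defines \<open>z ^ (k + 1)\<close>. The bound \<open>N\<close> on
  the support stays fixed while \<open>n\<close> decreases.
\<close>

lemma fps_power_nth_multinomial:
  fixes z :: "'a::field_char_0 laurent fps"
  assumes z0: "fps_nth z 0 = 0" and "n \<le> N"
  shows "const (1 / fact k) * fps_nth (z ^ k) n =
    (\<Sum>r | (\<forall>i. i \<notin> {1..N} \<longrightarrow> r i = 0) \<and> (\<Sum>i=1..N. r i) = k \<and> (\<Sum>i=1..N. i * r i) = n.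
      \<Prod>i=1..N. const (1 / fact (r i)) * fps_nth z i ^ r i)"
  using \<open>n \<le> N\<close>
proof (induction k arbitrary: n)
  case 0
  have "{r :: nat \<Rightarrow> nat. (\<forall>i. i \<notin> {1..N} \<longrightarrow> r i = 0) \<and> (\<Sum>i=1..N. r i) = 0 \<and> (\<Sum>i=1..N. i * r i) = n}
      = (if n = 0 then {\<lambda>_. 0} else {})"
    by (auto simp: fun_eq_iff) (metis atLeastAtMost_iff not_one_le_zero One_nat_def)+
  then show ?case
    by simp
next
  case (Suc k)
  define W where "W n k = {r :: nat \<Rightarrow> nat. (\<forall>i. i \<notin> {1..N} \<longrightarrow> r i = 0) \<and>
    (\<Sum>i=1..N. r i) = k \<and> (\<Sum>i=1..N. i * r i) = n}" for n k
  define u where "u i m = const (1 / fact m) * fps_nth z i ^ m" for i m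
  define w where "w r = (\<Prod>i=1..N. u i (r i))" for r
  have finW: "finite (W n k)" for n k
    unfolding W_def by (rule finite_bounded_partitions)
  have IH: "const (1 / fact k) * fps_nth (z ^ k) n = sum w (W n k)" if "n \<le> N" for n
    using Suc.IH [OF that] unfolding W_def w_def u_def .
  have u_Suc: "of_nat (Suc m) * u i (Suc m) = fps_nth z i * u i m" for i m
  proof -
    have "of_nat (Suc m) * const (1 / fact (Suc m)) = (const (1 / fact m) :: 'a laurent)"
      unfolding const_of_nat [symmetric] const_mult [symmetric] by (simp del: of_nat_Suc)
    then show ?thesis
      unfolding u_def by (simp only: power_Suc mult.assoc [symmetric]) (simp add: ac_simps)
  qed
  have w_upd: "of_nat (Suc (r i)) * w (r(i := Suc (r i))) = fps_nth z i * w r"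
    if "i \<in> {1..N}" for r i
  proof -
    have "(\<Prod>j\<in>{1..N} - {i}. u j ((r(i := Suc (r i))) j)) = (\<Prod>j\<in>{1..N} - {i}. u j (r j))"
      by (rule prod.cong) auto
    then have "w (r(i := Suc (r i))) = u i (Suc (r i)) * (\<Prod>j\<in>{1..N} - {i}. u j (r j))"
      unfolding w_def using that by (subst prod.remove [of _ i]) auto
    moreover have "w r = u i (r i) * (\<Prod>j\<in>{1..N} - {i}. u j (r j))"
      unfolding w_def using that by (subst prod.remove [of _ i]) auto
    ultimately show ?thesis
      using u_Suc [of "r i" i] by (simp only: mult.assoc [symmetric])
  qed
  \<comment> \<open>Stated additively because subtraction on \<open>nat\<close> truncates; applied
    both to the number of parts and to the weighted sum.\<close>
  have sum_upd: "(\<Sum>j=1..N. f j ((r(i := c)) j)) + f i (r i) = (\<Sum>j=1..N. f j (r j)) + f i c"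
    if "i \<in> {1..N}" for f :: "nat \<Rightarrow> nat \<Rightarrow> nat" and r i c
  proof -
    have "(\<Sum>j\<in>{1..N} - {i}. f j ((r(i := c)) j)) = (\<Sum>j\<in>{1..N} - {i}. f j (r j))"
      by (rule sum.cong) auto
    then show ?thesis
      using that sum.remove [of "{1..N}" i "\<lambda>j. f j ((r(i := c)) j)"]
        sum.remove [of "{1..N}" i "\<lambda>j. f j (r j)"]
      by (simp del: fun_upd_apply add: fun_upd_same)
  qed
  have inner: "(\<Sum>r\<in>W n (Suc k). of_nat (r i) * w r) =
      (if i \<le> n then fps_nth z i * sum w (W (n - i) k) else 0)" if i: "i \<in> {1..N}" for i
  proof -
    \<comment> \<open>A positive \<open>r i\<close> contributes at least \<open>i\<close> to the
      weighted sum \<open>n\<close>, so no index survives when \<open>i > n\<close>.\<close>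
    have le: "i \<le> n" if "r \<in> W n (Suc k)" "r i > 0" for r
    proof -
      have "i * r i \<le> (\<Sum>i=1..N. i * r i)"
        by (rule member_le_sum) (use i in auto)
      moreover have "i * 1 \<le> i * r i"
        using that by (intro mult_le_mono) auto
      ultimately have "i \<le> (\<Sum>i=1..N. i * r i)"
        by linarith
      then show ?thesis
        using that by (simp add: W_def)
    qed
    have "(\<Sum>r\<in>W n (Suc k). of_nat (r i) * w r) = (\<Sum>r\<in>{r \<in> W n (Suc k). r i > 0}. of_nat (r i) * w r)"
      by (rule sum.mono_neutral_right) (auto simp: finW)
    also have "\<dots> = (if i \<le> n then \<Sum>r\<in>W (n - i) k. fps_nth z i * w r else 0)"
    proof (cases "i \<le> n")
      case True
      have "(\<Sum>r\<in>{r \<in> W n (Suc k). r i > 0}. of_nat (r i) * w r) = (\<Sum>r\<in>W (n - i) k. fps_nth z i * w r)"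
      \<comment> \<open>Removing one part of size \<open>i\<close> and adding it back are mutually
        inverse.\<close>
      proof (rule sum.reindex_bij_witness [where j = "\<lambda>r. r(i := r i - 1)" and i = "\<lambda>r. r(i := Suc (r i))"])
        fix r assume r: "r \<in> {r \<in> W n (Suc k). r i > 0}"
        show "(r(i := r i - 1))(i := Suc ((r(i := r i - 1)) i)) = r"
          using r by auto
        show "fps_nth z i * w (r(i := r i - 1)) = of_nat (r i) * w r"
          using w_upd [OF i, of "r(i := r i - 1)"] r by auto
        have "(\<Sum>j=1..N. (r(i := r i - 1)) j) = k"
          using sum_upd [OF i, of "\<lambda>_ m. m" r "r i - 1"] r by (auto simp: W_def)
        moreover have "(\<Sum>j=1..N. j * (r(i := r i - 1)) j) = n - i"
        proof -
          have "i * r i = i * (r i - 1) + i"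
            using r by (cases "r i") auto
          then show ?thesis
            using sum_upd [OF i, of "\<lambda>j m. j * m" r "r i - 1"] r by (auto simp: W_def)
        qed
        ultimately show "r(i := r i - 1) \<in> W (n - i) k"
          using r by (auto simp: W_def)
      next
        fix r assume r: "r \<in> W (n - i) k"
        show "(r(i := Suc (r i)))(i := (r(i := Suc (r i))) i - 1) = r"
          by auto
        have "(\<Sum>j=1..N. (r(i := Suc (r i))) j) = Suc k"
          using sum_upd [OF i, of "\<lambda>_ m. m" r "Suc (r i)"] r by (auto simp: W_def)
        moreover have "(\<Sum>j=1..N. j * (r(i := Suc (r i))) j) = n"
          using sum_upd [OF i, of "\<lambda>j m. j * m" r "Suc (r i)"] r True by (auto simp: W_def)
        ultimately show "r(i := Suc (r i)) \<in> {r \<in> W n (Suc k). r i > 0}"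
          using r i by (auto simp: W_def)
      qed
      then show ?thesis
        using True by simp
    next
      case False
      then have "{r \<in> W n (Suc k). r i > 0} = {}"
        using le by blast
      then show ?thesis
        using False by (simp only: sum.empty if_False)
    qed
    finally show ?thesis
      by (simp add: sum_distrib_left)
  qed
  have "of_nat (Suc k) * sum w (W n (Suc k)) = (\<Sum>r\<in>W n (Suc k). \<Sum>i=1..N. of_nat (r i) * w r)"
  proof -
    have "of_nat (Suc k) * w r = (\<Sum>i=1..N. of_nat (r i) * w r)" if "r \<in> W n (Suc k)" for r
    proof -
      have "(\<Sum>i=1..N. r i) = Suc k"
        using that by (simp add: W_def)
      then have "of_nat (Suc k) * w r = of_nat (\<Sum>i=1..N. r i) * w r"
        by (simp only:)
      then show ?thesis
        by (simp only: of_nat_sum sum_distrib_right)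
    qed
    then show ?thesis
      by (simp add: sum_distrib_left)
  qed
  also have "\<dots> = (\<Sum>i=1..N. \<Sum>r\<in>W n (Suc k). of_nat (r i) * w r)"
    by (rule sum.swap)
  also have "\<dots> = (\<Sum>i=1..N. if i \<le> n then fps_nth z i * sum w (W (n - i) k) else 0)"
    by (rule sum.cong) (use inner in auto)
  also have "\<dots> = (\<Sum>i\<in>{1..N} \<inter> {i. i \<le> n}. fps_nth z i * sum w (W (n - i) k))"
    by (simp add: sum.inter_restrict)
  \<comment> \<open>The added term \<open>i = 0\<close> vanishes by \<open>z0\<close>; since
    \<open>n \<le> N\<close>, no other index is added.\<close>
  also have "\<dots> = (\<Sum>i=0..n. fps_nth z i * sum w (W (n - i) k))"
    using Suc.prems by (intro sum.mono_neutral_left) (auto simp: z0 Suc_le_eq intro!: gr0I)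
  also have "\<dots> = (\<Sum>i=0..n. fps_nth z i * (const (1 / fact k) * fps_nth (z ^ k) (n - i)))"
    using Suc.prems by (intro sum.cong) (auto simp: IH)
  also have "\<dots> = const (1 / fact k) * fps_nth (z ^ Suc k) n"
    by (simp add: fps_mult_nth sum_distrib_left ac_simps)
  also have "const (1 / fact k) = of_nat (Suc k) * (const (1 / fact (Suc k)) :: 'a laurent)"
    unfolding const_of_nat [symmetric] const_mult [symmetric] by (simp del: of_nat_Suc)
  finally have "of_nat (Suc k) * sum w (W n (Suc k)) =
      of_nat (Suc k) * (const (1 / fact (Suc k)) * fps_nth (z ^ Suc k) n)"
    by (simp only: mult.assoc)
  then have "const (1 / fact (Suc k)) * fps_nth (z ^ Suc k) n = sum w (W n (Suc k))"
    by (simp only: mult_cancel_left of_nat_eq_0_iff) simp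
  then show ?case
    unfolding W_def w_def u_def .
qed

text \<open>The constant term is 0 in place of \<open>H 0\<close>: for \<open>H = X\<close> the
  series is \<phi> - X_0, and any series can be composed with it.\<close>

definition egf :: "(nat \<Rightarrow> 'a::field_char_0 laurent) \<Rightarrow> 'a laurent fps" where
  "egf H = Abs_fps (\<lambda>n. if n = 0 then 0 else const (1 / fact n) * H n)"

lemma egf_nth_0 [simp]: "fps_nth (egf H) 0 = 0"
  by (simp add: egf_def)

text \<open>The multinomial expansion with \<open>N = n\<close>; the factors
  \<open>1 / fact i\<close> inside \<open>egf H\<close> supply the powers
  \<open>fact i ^ r i\<close> of the Bell coefficient.\<close>

lemma egf_power_nth:
  "const (fact n / fact k) * fps_nth (egf H ^ k) n =
    (\<Sum>r\<in>bell_index n k. const (fact n / (\<Prod>i=1..n. fact (r i) * fact i ^ r i)) * (\<Prod>i=1..n. H i ^ r i))"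
proof -
  have "const (fact n / fact k) * fps_nth (egf H ^ k) n =
      const (fact n) * (const (1 / fact k) * fps_nth (egf H ^ k) n)"
    by (simp flip: mult.assoc const_mult)
  also have "\<dots> = (\<Sum>r\<in>bell_index n k. const (fact n) *
      (\<Prod>i=1..n. const (1 / fact (r i)) * fps_nth (egf H) i ^ r i))"
    by (subst fps_power_nth_multinomial [of _ n n])
       (simp_all add: bell_index_def sum_distrib_left)
  also have "\<dots> = (\<Sum>r\<in>bell_index n k.
      const (fact n / (\<Prod>i=1..n. fact (r i) * fact i ^ r i)) * (\<Prod>i=1..n. H i ^ r i))"
  proof (rule sum.cong)
    fix r
    have "(\<Prod>i=1..n. const (1 / fact (r i)) * fps_nth (egf H) i ^ r i) =
        (\<Prod>i=1..n. const (1 / (fact (r i) * fact i ^ r i)) * H i ^ r i)"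
    proof (rule prod.cong)
      fix i assume "i \<in> {1..n}"
      then have "const (1 / fact (r i)) * fps_nth (egf H) i ^ r i =
          const (1 / fact (r i) * (1 / fact i) ^ r i) * H i ^ r i"
        unfolding const_mult const_power by (simp add: egf_def power_mult_distrib)
      also have "1 / fact (r i) * (1 / fact i) ^ r i = 1 / (fact (r i) * fact i ^ r i :: 'a)"
        by (simp add: power_one_over)
      finally show "const (1 / fact (r i)) * fps_nth (egf H) i ^ r i =
          const (1 / (fact (r i) * fact i ^ r i)) * H i ^ r i" .
    qed simp
    also have "\<dots> = const (1 / (\<Prod>i=1..n. fact (r i) * fact i ^ r i)) * (\<Prod>i=1..n. H i ^ r i)"
      by (simp only: prod.distrib const_prod [symmetric] prod_dividef prod.neutral_const)
    finally show "const (fact n) * (\<Prod>i=1..n. const (1 / fact (r i)) * fps_nth (egf H) i ^ r i) =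
        const (fact n / (\<Prod>i=1..n. fact (r i) * fact i ^ r i)) * (\<Prod>i=1..n. H i ^ r i)"
      by (simp flip: mult.assoc const_mult)
  qed simp
  finally show ?thesis .
qed

text \<open>The degenerate clauses of \<open>bell\<close> fit the power series, since
  \<open>egf X\<close> has zero constant term and its \<open>k\<close>-th power starts at order
  \<open>k\<close>.\<close>

lemma bell_eq_egf:
  "bell n k = const (fact n / fact k) * (fps_nth (egf X ^ k) n :: 'a::field_char_0 laurent)"
proof -
  consider "k = 0" | "n < k" | "k \<noteq> 0" "k \<le> n"
    by linarith
  then show ?thesis
  proof cases
    case 2
    then show ?thesis
      using startsby_zero_power_prefix [of "egf X :: 'a laurent fps" k] by (simp add: bell_def)
  next
    case 3
    then show ?thesis
      unfolding egf_power_nth by (simp add: bell_def)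
  qed (simp add: bell_def)
qed

lemma bell_in_laurent_X1 [simp]: "bell n k \<in> laurent_X1"
  unfolding bell_def
  by (auto intro!: laurent_X1_sum laurent_X1_mult laurent_X1_prod laurent_X1_power)

text \<open>Substitution replaces each \<open>X i\<close> in the partition sum by
  \<open>H i\<close>, and \<open>egf_power_nth\<close> reads the result as a power of
  \<open>egf H\<close>.\<close>

lemma subst_bell:
  fixes H :: "nat \<Rightarrow> 'a::field_char_0 laurent"
  assumes "H 1 dvd 1"
  shows "subst H (bell n k) = const (fact n / fact k) * fps_nth (egf H ^ k) n"
proof -
  consider "k = 0" | "n < k" | "k \<noteq> 0" "k \<le> n"
    by linarith
  then show ?thesis
  proof cases
    case 2
    then show ?thesis
      using startsby_zero_power_prefix [of "egf H" k] by (simp add: bell_def)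
  next
    case 3
    have "subst H (\<Prod>i=1..n. X i ^ r i) = (\<Prod>i=1..n. H i ^ r i)" for r
      by (subst subst_prod_X1 [where H = H, OF assms])
         (auto simp: laurent_X1_power subst_power_X1 [where H = H, OF assms] intro!: prod.cong)
    moreover have "(\<Prod>i=1..n. X i ^ r i) \<in> (laurent_X1 :: 'a laurent set)" for r
      by (intro laurent_X1_prod laurent_X1_power) auto
    ultimately show ?thesis
      unfolding egf_power_nth using 3
      by (simp add: bell_def subst_sum subst_mult_X1 [where H = H, OF assms])
  qed (simp add: bell_def)
qed

section \<open>Integer powers of \<phi>\<close>

text \<open>\<open>potential_fps r\<close> is \<open>\<phi>\<^sup>r\<close>, and \<open>binomial_fps r\<close> is \<open>(X\<^sub>0 + y)\<^sup>r\<close>.\<close>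

definition potential_fps :: "int \<Rightarrow> 'a::field_char_0 laurent fps" where
  "potential_fps r = Abs_fps (\<lambda>n. const (1 / fact n) * potential n r)"

definition binomial_fps :: "int \<Rightarrow> 'a::field_char_0 laurent fps" where
  "binomial_fps r = Abs_fps (\<lambda>j. const (of_int r gchoose j) * X_powi 0 (r - int j))"

lemma falling_eq_gbinomial: "falling r j = (fact j * (of_int r gchoose j) :: 'a::field_char_0)"
  by (simp add: falling_def gbinomial_prod_rev atLeast0LessThan)

text \<open>Inserting the series coefficient for \<open>bell n j\<close> cancels
  \<open>fact n\<close>, and dividing by \<open>fact j\<close> turns the falling factorial into a
  binomial coefficient.\<close>

lemma potential_fps_eq_compose: "potential_fps r = (binomial_fps r oo egf X :: 'a::field_char_0 laurent fps)"
proof (rule fps_ext)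
  fix n
  have "const (1 / fact n) * (const (falling r j) * X_powi 0 (r - int j) * bell n j) =
      const (of_int r gchoose j) * X_powi 0 (r - int j) * (fps_nth (egf X ^ j) n :: 'a laurent)" for j
  proof -
    have "const (1 / fact n) * (const (falling r j) * X_powi 0 (r - int j) * bell n j) =
        const (1 / fact n * falling r j * (fact n / fact j)) * X_powi 0 (r - int j) * (fps_nth (egf X ^ j) n :: 'a laurent)"
      by (simp only: bell_eq_egf const_mult ac_simps)
    also have "1 / fact n * falling r j * (fact n / fact j) = (of_int r gchoose j :: 'a)"
      by (simp add: falling_eq_gbinomial)
    finally show ?thesis .
  qed
  then show "fps_nth (potential_fps r) n = fps_nth (binomial_fps r oo egf X :: 'a laurent fps) n"
    by (simp only: potential_fps_def binomial_fps_def potential_def fps_compose_nth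
          fps_nth_Abs_fps sum_distrib_left)
qed

text \<open>Coefficientwise this is Vandermonde's identity for generalized binomials, which also
  covers negative exponents.\<close>

lemma binomial_fps_add: "binomial_fps (r + s) = (binomial_fps r * binomial_fps s :: 'a::field_char_0 laurent fps)"
proof (rule fps_ext)
  fix n
  have "fps_nth (binomial_fps r * binomial_fps s :: 'a laurent fps) n =
      (\<Sum>i=0..n. const ((of_int r gchoose i) * (of_int s gchoose (n - i))) * X_powi 0 (r + s - int n))"
    unfolding fps_mult_nth
  proof (rule sum.cong)
    fix i assume "i \<in> {0..n}"
    then have "r + s - int n = (r - int i) + (s - int (n - i))"
      by (simp add: of_nat_diff)
    then show "fps_nth (binomial_fps r) i * fps_nth (binomial_fps s) (n - i) =
        const ((of_int r gchoose i) * (of_int s gchoose (n - i))) * (X_powi 0 (r + s - int n) :: 'a laurent)"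
      by (simp only: X_powi_add) (simp add: binomial_fps_def const_mult ac_simps)
  qed simp
  also have "\<dots> = const (\<Sum>i=0..n. (of_int r gchoose i) * (of_int s gchoose (n - i))) * X_powi 0 (r + s - int n)"
    by (simp only: const_sum sum_distrib_right)
  also have "(\<Sum>i=0..n. (of_int r gchoose i) * (of_int s gchoose (n - i))) = (of_int (r + s) gchoose n :: 'a)"
    by (simp add: gbinomial_Vandermonde)
  finally show "fps_nth (binomial_fps (r + s)) n = fps_nth (binomial_fps r * binomial_fps s :: 'a laurent fps) n"
    by (simp add: binomial_fps_def)
qed

text \<open>Composition is multiplicative. With \<open>potential_fps_0\<close> this makes
  \<open>potential_fps (- r)\<close> the inverse of \<open>potential_fps r\<close>.\<close>

lemma potential_fps_add: "potential_fps (r + s) = potential_fps r * potential_fps s"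
  by (simp add: potential_fps_eq_compose binomial_fps_add fps_compose_mult_distrib)

lemma potential_fps_0 [simp]: "potential_fps 0 = (1 :: 'a::field_char_0 laurent fps)"
proof -
  have "binomial_fps 0 = (fps_const 1 :: 'a laurent fps)"
    by (rule fps_ext) (auto simp: binomial_fps_def gbinomial_0_left)
  then show ?thesis
    by (metis potential_fps_eq_compose fps_const_compose fps_const_1_eq_1)
qed

lemma potential_fps_nth_0: "fps_nth (potential_fps r) 0 = X_powi 0 r"
  by (simp add: potential_fps_eq_compose binomial_fps_def)

lemma potential_fps_power: "potential_fps r ^ k = potential_fps (int k * r)"
  by (induction k) (simp_all add: potential_fps_add distrib_right)

text \<open>The chain rule, with (X_0 + y)^r differentiated by the absorption identity.
  \<open>egf X\<close> differs from \<phi> by a constant, so its derivative is \<phi>'.\<close>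

lemma fps_deriv_potential_fps:
  "fps_deriv (potential_fps r) =
    of_int r * potential_fps (r - 1) * fps_deriv (egf X :: 'a::field_char_0 laurent fps)"
proof -
  have "fps_deriv (binomial_fps r) = fps_const (of_int r) * (binomial_fps (r - 1) :: 'a laurent fps)"
  proof (rule fps_ext)
    fix j
    have "of_nat (Suc j) * const (of_int r gchoose Suc j) =
        of_int r * (const (of_int (r - 1) gchoose j) :: 'a laurent)"
      unfolding const_of_nat [symmetric] const_of_int [symmetric] const_mult [symmetric]
      by (subst gbinomial_absorption) simp
    moreover have "X_powi 0 (r - int (Suc j)) = (X_powi 0 (r - 1 - int j) :: 'a laurent)"
      by (rule arg_cong) simp
    ultimately show "fps_nth (fps_deriv (binomial_fps r)) j =
        fps_nth (fps_const (of_int r) * (binomial_fps (r - 1) :: 'a laurent fps)) j"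
      by (simp add: binomial_fps_def del: of_nat_Suc flip: mult.assoc)
  qed
  then show ?thesis
    by (simp only: potential_fps_eq_compose fps_compose_deriv fps_compose_mult_distrib
          egf_nth_0 fps_const_compose) (simp only: fps_of_int)
qed

section \<open>Lagrange inversion\<close>

text \<open>
  For \<open>n \<noteq> k\<close> the coefficient vanishes because \<open>\<phi>\<^sup>n (y\<^sup>k \<phi>\<^sup>-\<^sup>k)'\<close> differs from a multiple of the
  derivative of \<open>y\<^sup>k\<^sup>-\<^sup>n \<phi>\<^sup>n\<^sup>-\<^sup>k\<close> only by a factor \<open>y\<^sup>n\<close>, and a derivative has no residue.
\<close>

lemma residue_potential_fps:
  "fps_nth (fps_X * fps_deriv (fps_X ^ k * potential_fps (- int k)) *
      (potential_fps (int n) :: 'a::field_char_0 laurent fps)) n = (if n = k then of_nat k else 0)"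
proof -
  let ?D = "fps_deriv (egf X) :: 'a laurent fps"
  let ?P = "potential_fps :: int \<Rightarrow> 'a laurent fps"
  have X: "fps_X * fps_deriv (fps_X ^ k) = of_nat k * (fps_X ^ k :: 'a laurent fps)"
    by (cases k) (simp, simp only: fps_deriv_power', simp add: ac_simps del: of_nat_Suc)
  have "fps_X * fps_deriv (fps_X ^ k * ?P (- int k)) * ?P (int n) =
      (fps_X * fps_deriv (fps_X ^ k)) * (?P (- int k) * ?P (int n)) -
      of_nat k * (fps_X ^ Suc k * ((?P (- int k - 1) * ?P (int n)) * ?D))"
    by (simp add: fps_deriv_potential_fps algebra_simps)
  also have "?P (- int k) * ?P (int n) = ?P (int n - int k)"
    by (simp flip: potential_fps_add)
  also have "?P (- int k - 1) * ?P (int n) = ?P (int n - int k - 1)"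
    by (simp add: algebra_simps flip: potential_fps_add)
  finally have eq: "fps_X * fps_deriv (fps_X ^ k * ?P (- int k)) * ?P (int n) =
      fps_const (of_nat k) * (fps_X ^ k * ?P (int n - int k)) -
      fps_const (of_nat k) * (fps_X ^ Suc k * (?P (int n - int k - 1) * ?D))"
    by (simp add: X fps_of_nat mult.assoc)
  \<comment> \<open>For \<open>n < k\<close> both terms of \<open>eq\<close> vanish; for
    \<open>n = k\<close> only the first can contribute; for \<open>n > k\<close> they
    cancel.\<close>
  consider "n < k" | "n = k" | d where "n = Suc d + k"
    by (metis add.commute less_imp_Suc_add linorder_neqE_nat add_Suc_right)
  then show ?thesis
  proof cases
    case 3
    \<comment> \<open>The second term is evaluated through (d + 1) \<phi>^d \<phi>' = (\<phi>^(d +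
      1))'.\<close>
    have "of_nat (Suc d) * fps_nth (?P (int d) * ?D) d = fps_nth (fps_deriv (?P (int (Suc d)))) d"
      by (subst fps_deriv_potential_fps)
         (simp only: mult.assoc of_int_of_nat_eq fps_of_nat [symmetric] fps_mult_left_const_nth, simp)
    also have "\<dots> = of_nat (Suc d) * fps_nth (?P (int (Suc d))) (Suc d)"
      by (simp del: of_nat_Suc)
    finally have "fps_nth (?P (int d) * ?D) d = fps_nth (?P (int (Suc d))) (Suc d)"
      by (simp only: mult_cancel_left of_nat_eq_0_iff) simp
    then show ?thesis
      unfolding eq using 3 by (simp add: fps_X_power_mult_nth del: power_Suc)
  qed (unfold eq, simp_all add: fps_X_power_mult_nth del: power_Suc)
qed

text \<open>The value that Lagrange inversion predicts for \<open>[x^n] T^k\<close>. Row 0 is given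
  separately, since division by zero yields 0 where the entry at \<open>n = k = 0\<close> must be
  1.\<close>

definition lagrange_coeff :: "nat \<Rightarrow> nat \<Rightarrow> 'a::field_char_0 laurent" where
  "lagrange_coeff n k = (if n = 0 then (if k = 0 then 1 else 0)
     else const (of_nat k / of_nat n) * fps_nth (fps_X ^ k * potential_fps (int n)) n)"

text \<open>The series \<open>y / \<phi>\<close>.\<close>

definition kernel_fps :: "'a::field_char_0 laurent fps" where
  "kernel_fps = fps_X * potential_fps (- 1)"

lemma kernel_fps_nth_0 [simp]: "fps_nth kernel_fps 0 = 0"
  by (simp add: kernel_fps_def)

lemma kernel_fps_power: "kernel_fps ^ k = fps_X ^ k * potential_fps (- int k)"
  by (simp add: kernel_fps_def power_mult_distrib potential_fps_power)

lemma kernel_fps_power_nth: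
  "fps_nth (kernel_fps ^ k) n = (if n < k then 0 else fps_nth (potential_fps (- int k)) (n - k))"
  by (simp add: kernel_fps_power fps_X_power_mult_nth)

lemma lagrange_coeff_eq_0 [simp]: "n < k \<Longrightarrow> lagrange_coeff n k = 0"
  by (simp add: lagrange_coeff_def fps_X_power_mult_nth)

lemma lagrange_coeff_diag: "lagrange_coeff n n = X_powi 0 (int n)"
  by (simp add: lagrange_coeff_def fps_X_power_mult_nth potential_fps_nth_0)

text \<open>After multiplication by \<open>n\<close>, the factor \<open>j\<close> from
  \<open>lagrange_coeff\<close> becomes the operator y d/dy on \<open>kernel_fps ^ k\<close>; the
  sum is then a Cauchy product, evaluated by \<open>residue_potential_fps\<close>.\<close>

lemma lagrange_coeff_mult_kernel:
  "(\<Sum>j=0..n. lagrange_coeff n j * fps_nth (kernel_fps ^ k) j) =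
    (if n = k then 1 else 0 :: 'a::field_char_0 laurent)"
proof (cases "n = 0")
  case True
  then show ?thesis
    by (auto simp: lagrange_coeff_def)
next
  case False
  have "of_nat n * (\<Sum>j=0..n. lagrange_coeff n j * fps_nth (kernel_fps ^ k) j) =
      (\<Sum>j=0..n. fps_nth (fps_X * fps_deriv (kernel_fps ^ k)) j *
        (fps_nth (potential_fps (int n)) (n - j) :: 'a laurent))"
    unfolding sum_distrib_left
  proof (rule sum.cong)
    fix j assume j: "j \<in> {0..n}"
    have "of_nat n * const (of_nat j / of_nat n) = (of_nat j :: 'a laurent)"
      unfolding const_of_nat [symmetric] const_mult [symmetric] using False by simp
    then have "of_nat n * lagrange_coeff n j = of_nat j * (fps_nth (potential_fps (int n)) (n - j) :: 'a laurent)"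
      using j False by (simp add: lagrange_coeff_def fps_X_power_mult_nth flip: mult.assoc)
    moreover have "fps_nth (fps_X * fps_deriv (kernel_fps ^ k)) j = of_nat j * (fps_nth (kernel_fps ^ k) j :: 'a laurent)"
      by (cases j) auto
    ultimately show "of_nat n * (lagrange_coeff n j * fps_nth (kernel_fps ^ k) j) =
        fps_nth (fps_X * fps_deriv (kernel_fps ^ k)) j * (fps_nth (potential_fps (int n)) (n - j) :: 'a laurent)"
      by (simp only: mult.assoc [symmetric]) (simp only: ac_simps)
  qed simp
  also have "\<dots> = (if n = k then of_nat k else 0)"
    unfolding fps_mult_nth [symmetric] kernel_fps_power by (rule residue_potential_fps)
  finally have "of_nat n * (\<Sum>j=0..n. lagrange_coeff n j * fps_nth (kernel_fps ^ k) j) =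
      of_nat n * (if n = k then 1 else 0 :: 'a laurent)"
    by simp
  then show ?thesis
    using False by (simp only: mult_cancel_left of_nat_eq_0_iff) simp
qed

text \<open>Forward substitution: row \<open>n\<close> determines \<open>v n\<close> once all
  earlier entries agree.\<close>

lemma triangular_left_cancel:
  fixes v w :: "nat \<Rightarrow> 'b::idom"
  assumes "\<And>n. b n n \<noteq> 0"
    and "\<And>n. (\<Sum>j=0..n. b n j * v j) = (\<Sum>j=0..n. b n j * w j)"
  shows "v n = w n"
proof (induction n rule: less_induct)
  case (less n)
  have "(\<Sum>j\<in>{0..n} - {n}. b n j * v j) = (\<Sum>j\<in>{0..n} - {n}. b n j * w j)"
    by (rule sum.cong) (use less in auto)
  with assms(2) [of n] have "b n n * v n = b n n * w n"
    by (simp add: sum.remove [of "{0..n}" n])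
  with assms(1) show ?case
    by simp
qed

text \<open>Back substitution: column \<open>k\<close> determines \<open>v k\<close> once all later
  entries up to \<open>n\<close> agree, hence the induction on \<open>n - k\<close>.\<close>

lemma triangular_right_cancel:
  fixes v w :: "nat \<Rightarrow> 'b::idom"
  assumes "\<And>k. b k k \<noteq> 0"
    and "\<And>k. k \<le> n \<Longrightarrow> (\<Sum>j=k..n. v j * b j k) = (\<Sum>j=k..n. w j * b j k)"
    and "k \<le> n"
  shows "v k = w k"
  using \<open>k \<le> n\<close>
proof (induction "n - k" arbitrary: k rule: less_induct)
  case less
  have "(\<Sum>j\<in>{k..n} - {k}. v j * b j k) = (\<Sum>j\<in>{k..n} - {k}. w j * b j k)"
    by (rule sum.cong) (use less in auto)
  with assms(2) [of k] less.prems have "v k * b k k = w k * b k k"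
    by (simp add: sum.remove [of "{k..n}" k])
  with assms(1) show ?case
    by simp
qed

text \<open>With L the Lagrange matrix and M the kernel matrix, L M = 1 gives L (M L) = L, and L
  cancels because its diagonal consists of powers of X_0.\<close>

lemma kernel_mult_lagrange_coeff:
  "(\<Sum>j=0..n. fps_nth (kernel_fps ^ j) n * lagrange_coeff j k) =
    (if n = k then 1 else 0 :: 'a::field_char_0 laurent)"
proof (rule triangular_left_cancel [where b = lagrange_coeff and
    v = "\<lambda>n. \<Sum>j=0..n. fps_nth (kernel_fps ^ j) n * lagrange_coeff j k" and
    w = "\<lambda>n. if n = k then 1 else 0"])
  fix n
  let ?M = "\<lambda>m j. fps_nth (kernel_fps ^ j) m :: 'a laurent"
  \<comment> \<open>The inner range extends to \<open>n\<close> because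
    \<open>kernel_fps ^ j\<close> has order at least \<open>j\<close>; the sums can then be
    swapped.\<close>
  have "(\<Sum>m=0..n. lagrange_coeff n m * (\<Sum>j=0..m. ?M m j * lagrange_coeff j k)) =
      (\<Sum>m=0..n. \<Sum>j=0..n. lagrange_coeff n m * (?M m j * lagrange_coeff j k))"
    unfolding sum_distrib_left
    by (intro sum.cong sum.mono_neutral_left) (auto simp: kernel_fps_power_nth)
  also have "\<dots> = (\<Sum>j=0..n. \<Sum>m=0..n. lagrange_coeff n m * (?M m j * lagrange_coeff j k))"
    by (rule sum.swap)
  also have "\<dots> = (\<Sum>j=0..n. (\<Sum>m=0..n. lagrange_coeff n m * ?M m j) * lagrange_coeff j k)"
    by (simp only: sum_distrib_right mult.assoc)
  also have "\<dots> = lagrange_coeff n k"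
    by (simp add: lagrange_coeff_mult_kernel mult_delta_left)
  also have "\<dots> = (\<Sum>m=0..n. lagrange_coeff n m * (if m = k then 1 else 0))"
    by (simp add: mult_delta_right)
  finally show "(\<Sum>m=0..n. lagrange_coeff n m * (\<Sum>j=0..m. ?M m j * lagrange_coeff j k)) =
    (\<Sum>m=0..n. lagrange_coeff n m * (if m = k then 1 else 0))" .
qed (simp add: lagrange_coeff_diag)

section \<open>Tree polynomials and the powers of their generating function\<close>

lemma tree_eq_potential: "n \<ge> 1 \<Longrightarrow> tree n = potential (n - 1) (int n)"
  unfolding tree_def potential_def
  by (rule sum.cong) (auto simp: X_powi_power of_nat_diff)

lemma tree_1: "tree 1 = X 0"
  by (simp add: tree_def falling_def bell_def)

text \<open>Makes the substitution meaningful for the negative powers of \<open>X 1\<close> allowed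
  in the inverse family.\<close>

lemma tree_1_unit: "tree 1 dvd 1"
  unfolding tree_1 by (rule dvdI [of _ _ "X_powi 0 (- 1)"]) (simp flip: X_powi_add)

text \<open>The case \<open>k = 1\<close>: T_n / n! = (1/n) [y^(n - 1)] \<phi>^n.\<close>

lemma egf_tree_nth: "fps_nth (egf tree) n = lagrange_coeff n 1"
proof (cases n)
  case (Suc m)
  have "const (1 / of_nat (Suc m)) * const (1 / fact m) = const (1 / fact (Suc m) :: 'a)"
    unfolding const_mult [symmetric] by simp
  with Suc show ?thesis
    by (simp add: egf_def lagrange_coeff_def tree_eq_potential potential_fps_def
          del: of_nat_Suc fact_Suc One_nat_def flip: mult.assoc)
qed (simp add: lagrange_coeff_def)

text \<open>Both \<open>egf tree ^ k\<close> and the series of column \<open>k\<close> give y^k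
  after composition with \<open>kernel_fps\<close>. This composition is injective, as
  \<open>kernel_fps\<close> has zero constant term and linear coefficient X_0^(-1).\<close>

lemma egf_tree_power_nth: "fps_nth (egf tree ^ k) n = (lagrange_coeff n k :: 'a::field_char_0 laurent)"
proof -
  have comp: "Abs_fps (\<lambda>n. lagrange_coeff n k) oo kernel_fps = (fps_X ^ k :: 'a laurent fps)" for k
    by (rule fps_ext)
       (simp add: fps_compose_nth kernel_mult_lagrange_coeff mult.commute [of "lagrange_coeff _ _"])
  have "egf tree = (Abs_fps (\<lambda>n. lagrange_coeff n 1) :: 'a laurent fps)"
    by (rule fps_ext) (simp add: egf_tree_nth)
  then have "egf tree ^ k oo kernel_fps = (fps_X ^ k :: 'a laurent fps)"
    using comp [of 1] by (simp flip: fps_compose_power)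
  also have "\<dots> = Abs_fps (\<lambda>n. lagrange_coeff n k) oo kernel_fps"
    by (simp add: comp)
  finally have "egf tree ^ k = (Abs_fps (\<lambda>n. lagrange_coeff n k) :: 'a laurent fps)"
    by (subst (asm) fps_compose_inj_right) (simp_all add: kernel_fps_def potential_fps_nth_0)
  then show ?thesis
    by simp
qed

section \<open>Existence and uniqueness of the inverse family\<close>

lemma bell_diag: "bell n n = X_powi 1 (int n)"
  using startsby_zero_power_nth_same [of "egf X" n]
  by (simp add: bell_eq_egf) (simp add: egf_def X_powi_power)

text \<open>The defining identity solved for \<open>A n k\<close>: the term \<open>j = k\<close>
  carries the invertible factor \<open>bell k k\<close>, a power of \<open>X 1\<close>, and the
  other terms have larger second index.\<close>

function inverse_bell_rec :: "nat \<Rightarrow> nat \<Rightarrow> 'a::field_char_0 laurent" where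
  "inverse_bell_rec n k = (if n < k then 0 else
     ((if n = k then 1 else 0) - (\<Sum>j=Suc k..n. inverse_bell_rec n j * bell j k)) * X_powi 1 (- int k))"
  by auto
termination
  by (relation "measure (\<lambda>(n, k). n - k)") auto

declare inverse_bell_rec.simps [simp del]

lemma inverse_bell_rec_in_laurent_X1:
  "inverse_bell_rec n k \<in> (laurent_X1 :: 'a::field_char_0 laurent set)"
proof (induction n k rule: inverse_bell_rec.induct)
  case (1 n k)
  have "(\<Sum>j=Suc k..n. inverse_bell_rec n j * bell j k) \<in> (laurent_X1 :: 'a laurent set)" if "\<not> n < k"
    by (intro laurent_X1_sum laurent_X1_mult bell_in_laurent_X1) (use 1 that in auto)
  then show ?case
    unfolding inverse_bell_rec.simps [of n k] diff_conv_add_uminus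
    by (auto intro!: laurent_X1_mult laurent_X1_add laurent_X1_uminus simp del: add_uminus_conv_diff One_nat_def)
qed

lemma is_inverse_bell_family_rec:
  "is_inverse_bell_family (inverse_bell_rec :: nat \<Rightarrow> nat \<Rightarrow> 'a::field_char_0 laurent)"
proof -
  have "(\<Sum>j=k..n. inverse_bell_rec n j * bell j k) = (if n = k then 1 else 0 :: 'a laurent)" for n k
  proof (cases "k \<le> n")
    case True
    have "inverse_bell_rec n k * bell k k =
        ((if n = k then 1 else 0) - (\<Sum>j=Suc k..n. inverse_bell_rec n j * bell j k)) *
        (X_powi 1 (- int k) * X_powi 1 (int k))"
      using True by (subst inverse_bell_rec.simps) (simp add: bell_diag)
    also have "X_powi 1 (- int k) * X_powi 1 (int k) = (1 :: 'a laurent)"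
      by (simp flip: X_powi_add)
    finally show ?thesis
      by (simp only: sum.atLeast_Suc_atMost [OF True]) simp
  qed simp
  moreover have "inverse_bell_rec n 0 = (0 :: 'a laurent)" if "n \<ge> 1" for n
    using that by (subst inverse_bell_rec.simps) (auto simp: bell_def intro!: sum.neutral)
  moreover have "inverse_bell_rec 0 0 = (1 :: 'a laurent)"
    by (subst inverse_bell_rec.simps) simp
  moreover have "inverse_bell_rec n k = (0 :: 'a laurent)" if "n < k" for n k
    using that by (subst inverse_bell_rec.simps) simp
  ultimately show ?thesis
    by (auto simp: is_inverse_bell_family_def inverse_bell_rec_in_laurent_X1)
qed

text \<open>Row \<open>n\<close> of either family solves the same triangular system, whose diagonal
  consists of powers of \<open>X 1\<close>.\<close>

lemma is_inverse_bell_family_unique: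
  fixes A A' :: "nat \<Rightarrow> nat \<Rightarrow> 'a::field_char_0 laurent"
  assumes "is_inverse_bell_family A" "is_inverse_bell_family A'"
  shows "A = A'"
proof (intro ext)
  fix n k
  show "A n k = A' n k"
  proof (cases "k \<le> n")
    case True
    show ?thesis
      by (rule triangular_right_cancel [where b = bell and n = n])
         (use assms True in \<open>auto simp: is_inverse_bell_family_def bell_diag\<close>)
  qed (use assms in \<open>simp add: is_inverse_bell_family_def\<close>)
qed

lemma is_inverse_bell_family_inverse_bell: "is_inverse_bell_family inverse_bell"
  unfolding inverse_bell_def
  by (rule theI [where P = is_inverse_bell_family, OF is_inverse_bell_family_rec])
     (rule is_inverse_bell_family_unique [OF _ is_inverse_bell_family_rec])

section \<open>Substitution of the tree polynomials\<close>

lemma subst_tree_bell: "subst tree (bell n k) = const (fact n / fact k) * lagrange_coeff n k"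
  using subst_bell [where H = tree, OF tree_1_unit] by (simp add: egf_tree_power_nth)

text \<open>As functions of \<open>k\<close>, both sides are row \<open>n\<close> of a left inverse
  of the matrix \<open>subst tree (bell j k)\<close>: one by substitution into the identity defining
  \<open>inverse_bell\<close>, the other by \<open>kernel_mult_lagrange_coeff\<close> after
  rescaling rows and columns by factorials.\<close>

lemma subst_tree_inverse_bell:
  assumes "k \<le> n"
  shows "subst tree (inverse_bell n k) =
    const (fact n / fact k) * (fps_nth (kernel_fps ^ k) n :: 'a::field_char_0 laurent)"
proof (rule triangular_right_cancel [where b = "\<lambda>j k. subst tree (bell j k) :: 'a laurent" and n = n and
    v = "\<lambda>k. subst tree (inverse_bell n k)" and
    w = "\<lambda>k. const (fact n / fact k) * fps_nth (kernel_fps ^ k) n"])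
  fix k assume k: "k \<le> n"
  have fam: "is_inverse_bell_family (inverse_bell :: nat \<Rightarrow> nat \<Rightarrow> 'a laurent)"
    by (rule is_inverse_bell_family_inverse_bell)
  have "(\<Sum>j=k..n. subst tree (inverse_bell n j) * subst tree (bell j k)) =
      subst tree (\<Sum>j=k..n. inverse_bell n j * bell j k :: 'a laurent)"
    using fam unfolding subst_sum
    by (intro sum.cong refl subst_mult_X1 [symmetric] tree_1_unit bell_in_laurent_X1)
       (auto simp: is_inverse_bell_family_def)
  also have "\<dots> = (if n = k then 1 else 0)"
    using fam by (simp add: is_inverse_bell_family_def)
  \<comment> \<open>For \<open>n = k\<close> the factorial quotient is 1; otherwise both sides are
    0.\<close>
  also have "\<dots> = const (fact n / fact k) * (\<Sum>j=0..n. fps_nth (kernel_fps ^ j) n * lagrange_coeff j k)"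
    by (simp add: kernel_mult_lagrange_coeff)
  also have "\<dots> = const (fact n / fact k) * (\<Sum>j=k..n. fps_nth (kernel_fps ^ j) n * lagrange_coeff j k)"
    by (intro arg_cong2 [where f = "(*)"] refl sum.mono_neutral_right) auto
  also have "\<dots> = (\<Sum>j=k..n. const (fact n / fact j) * fps_nth (kernel_fps ^ j) n * subst tree (bell j k))"
    unfolding sum_distrib_left
  proof (rule sum.cong)
    fix j
    have "const (fact n / fact k) = const (fact n / fact j) * (const (fact j / fact k) :: 'a laurent)"
      by (simp flip: const_mult)
    then show "const (fact n / fact k) * (fps_nth (kernel_fps ^ j) n * lagrange_coeff j k) =
        const (fact n / fact j) * fps_nth (kernel_fps ^ j) n * (subst tree (bell j k) :: 'a laurent)"
      by (simp add: subst_tree_bell ac_simps)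
  qed simp
  finally show "(\<Sum>j=k..n. subst tree (inverse_bell n j) * subst tree (bell j k)) =
      (\<Sum>j=k..n. const (fact n / fact j) * fps_nth (kernel_fps ^ j) n * (subst tree (bell j k) :: 'a laurent))" .
qed (use assms in \<open>simp_all add: subst_tree_bell lagrange_coeff_diag\<close>)

theorem theorem5p11:
  fixes n k :: nat
  assumes "1 \<le> k" and "k \<le> n"
  shows "subst tree (bell n k :: 'a::field_char_0 laurent) =
           of_nat ((n - 1) choose (k - 1)) * potential (n - k) (int n) \<and>
         subst tree (inverse_bell n k :: 'a laurent) =
           of_nat (n choose k) * potential (n - k) (- int k)"
proof
  have n: "n \<noteq> 0"
    using assms by simp
  have "subst tree (bell n k :: 'a laurent) =
      const (fact n / fact k * (of_nat k / of_nat n) * (1 / fact (n - k))) * potential (n - k) (int n)"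
    unfolding const_mult using assms
    by (simp add: subst_tree_bell lagrange_coeff_def fps_X_power_mult_nth potential_fps_def mult.assoc)
  \<comment> \<open>Since n!/k! * k/n = (n - 1)!/(k - 1)!, passing to the predecessors of
    \<open>n\<close> and \<open>k\<close> exposes the binomial coefficient.\<close>
  also have "fact n / fact k * (of_nat k / of_nat n) * (1 / fact (n - k)) =
      (of_nat ((n - 1) choose (k - 1)) :: 'a)"
    using assms by (cases n; cases k) (simp_all add: binomial_fact divide_simps del: of_nat_Suc)
  finally show "subst tree (bell n k :: 'a laurent) =
      of_nat ((n - 1) choose (k - 1)) * potential (n - k) (int n)"
    by (simp add: const_of_nat)
  have "subst tree (inverse_bell n k :: 'a laurent) =
      const (fact n / fact k * (1 / fact (n - k))) * potential (n - k) (- int k)"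
    unfolding const_mult using assms
    by (simp add: subst_tree_inverse_bell kernel_fps_power_nth potential_fps_def mult.assoc)
  also have "fact n / fact k * (1 / fact (n - k)) = (of_nat (n choose k) :: 'a)"
    using assms by (simp add: binomial_fact)
  finally show "subst tree (inverse_bell n k :: 'a laurent) =
      of_nat (n choose k) * potential (n - k) (- int k)"
    by (simp add: const_of_nat)
qed

end
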